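(* Let $p$ be a prime and let $k\ge2$. Suppose that, locally at $p$, $\alpha=\beta*\gamma$, where $\beta$ is a positive function of degree 1 at $p$ and $\gamma$ is the convolution inverse of a positive function of degree $k-1$ at $p$, and that $\alpha$ is non-trivial and this product is in normal form. Let $F_n=\alpha(p^n)$, let $t'_1=\beta(p)$, let $F''_j=\gamma(p^j)$, and let $s''_j$ $(j\ge1)$ be the parameters at $p$ of $\gamma^{-1}$, with $s''_0=-1$. Then for all $n\ge0$, $$F_n=-\sum_{j=0}^n(t'_1)^{n-j}s''_j=\sum_{j=0}^n(t'_1)^{n-j}F''_j.$$
   Context: A multiplicative arithmetic function is a function $\alpha:\mathbb{N}_{\ge1}\to\mathbb{C}$, not identically zero, with $\alpha(mn)=\alpha(m)\alpha(n)$ whenever $\gcd(m,n)=1$. Dirichlet convolution is $(\alpha*\beta)(n)=\sum_{d\mid n}\alpha(d)\beta(n/d)$. Generalized Fibonacci polynomials: $F_0=1$ and, for $n\ge1$, $F_n(t_1,\dots,t_n)=\sum\binom{a_1+\dots+a_n}{a_1,\dots,a_n}t_1^{a_1}\cdots t_n^{a_n}$, the sum being over tuples of non-negative integers with $\sum_j ja_j=n$. The parameters of a multiplicative function $\alpha$ at $p$ are the unique complex numbers $t_1,t_2,\dots$ such that $F_n(t_1,\dots,t_n)=\alpha(p^n)$ for all $n\ge0$. The degree of $\alpha$ at $p$ is $k$ if $t_k\ne0$ and $t_j=0$ for $j>k$. A function has degree 1 at $p$ iff its values on powers of $p$ are $p^n\mapsto b^n$ with $b\neq0$. A positive function of degree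 $m$ at $p$ is, on powers of $p$, a convolution product of $m$ functions of degree 1 at $p$. A convolution product of degree-1 functions and inverses of degree-1 functions is in normal form if no two factors are mutually inverse (on powers of $p$). *)

theory Defs
  imports Complex_Main "HOL-Computational_Algebra.Primes" "HOL-Library.FuncSet"
begin

text \<open>
  Arithmetic functions live on the positive integers; here they have type
  \<^typ>\<open>nat \<Rightarrow> complex\<close>, and no notion below inspects their value at \<open>0\<close>.
\<close>

definition multiplicative :: "(nat \<Rightarrow> complex) \<Rightarrow> bool" where
  "multiplicative f \<longleftrightarrow>
     (\<exists>n\<ge>1. f n \<noteq> 0) \<and>
     (\<forall>m\<ge>1. \<forall>n\<ge>1. coprime m n \<longrightarrow> f (m * n) = f m * f n)"

definition dirichlet_conv :: "(nat \<Rightarrow> complex) \<Rightarrow> (nat \<Rightarrow> complex) \<Rightarrow> nat \<Rightarrow> complex"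
    (infixl \<open>\<star>\<close> 70) where
  "(f \<star> g) n = (\<Sum>d | d dvd n. f d * g (n div d))"

definition conv_one :: "nat \<Rightarrow> complex" where
  "conv_one n = (if n = 1 then 1 else 0)"

text \<open>
  The convolution inverse, by the usual recursion on divisors; see
  \<open>dirichlet_conv_inverse\<close> below. It is meaningful when \<open>f 1 \<noteq> 0\<close>.
\<close>

function conv_inverse :: "(nat \<Rightarrow> complex) \<Rightarrow> nat \<Rightarrow> complex" where
  "conv_inverse f n =
     (if n = 0 then 0
      else if n = 1 then 1 / f 1
      else - (1 / f 1) * (\<Sum>d | d dvd n \<and> d < n. f (n div d) * conv_inverse f d))"
  by auto
termination by (relation "measure snd") auto

declare conv_inverse.simps [simp del]

lemma dirichlet_conv_inverse:
  assumes "f 1 \<noteq> 0" and "n \<ge> 1"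
  shows "(conv_inverse f \<star> f) n = conv_one n"
proof (cases "n = 1")
  case True
  then show ?thesis
    using assms
    by (simp add: dirichlet_conv_def conv_one_def conv_inverse.simps[of f "Suc 0"])
next
  case False
  have split: "{d. d dvd n} = insert n {d. d dvd n \<and> d < n}"
    using assms(2) by (auto dest: dvd_imp_le)
  have "(conv_inverse f \<star> f) n =
      conv_inverse f n * f 1 + (\<Sum>d | d dvd n \<and> d < n. conv_inverse f d * f (n div d))"
    unfolding dirichlet_conv_def split using assms(2) by (subst sum.insert) auto
  also have "conv_inverse f n * f 1 =
      - (\<Sum>d | d dvd n \<and> d < n. f (n div d) * conv_inverse f d)"
    using assms False by (subst conv_inverse.simps) (simp add: field_simps)
  finally show ?thesis
    using False by (simp add: conv_one_def mult.commute)
qed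

definition agree_at :: "nat \<Rightarrow> (nat \<Rightarrow> complex) \<Rightarrow> (nat \<Rightarrow> complex) \<Rightarrow> bool" where
  "agree_at p f g \<longleftrightarrow> (\<forall>n. f (p ^ n) = g (p ^ n))"

text \<open>
  The exponent tuples \<open>(a\<^sub>1, \<dots>, a\<^sub>n)\<close> of weight \<open>n\<close>. The bound \<open>a\<^sub>j \<le> n\<close> is implied by
  the weight condition; it only makes the set evidently finite.
\<close>

definition weighted_exponents :: "nat \<Rightarrow> (nat \<Rightarrow> nat) set" where
  "weighted_exponents n = {a \<in> {1..n} \<rightarrow>\<^sub>E {..n}. (\<Sum>j=1..n. j * a j) = n}"

definition gen_fib :: "nat \<Rightarrow> (nat \<Rightarrow> complex) \<Rightarrow> complex" where
  "gen_fib n t =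
     (\<Sum>a\<in>weighted_exponents n.
        fact (\<Sum>j=1..n. a j) / (\<Prod>j=1..n. fact (a j)) * (\<Prod>j=1..n. t j ^ a j))"

lemma gen_fib_0: "gen_fib 0 t = 1"
  by (simp add: gen_fib_def weighted_exponents_def)

text \<open>
  \<open>t 0\<close> is not a parameter and is left unconstrained, so that the convention
  \<open>t 0 = -1\<close> can be imposed separately.
\<close>

definition parameters_at :: "nat \<Rightarrow> (nat \<Rightarrow> complex) \<Rightarrow> (nat \<Rightarrow> complex) \<Rightarrow> bool" where
  "parameters_at p f t \<longleftrightarrow> (\<forall>n. gen_fib n t = f (p ^ n))"

definition degree_at :: "nat \<Rightarrow> (nat \<Rightarrow> complex) \<Rightarrow> nat \<Rightarrow> bool" where
  "degree_at p f k \<longleftrightarrow>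
     k \<ge> 1 \<and> (\<exists>t. parameters_at p f t \<and> t k \<noteq> 0 \<and> (\<forall>j>k. t j = 0))"

definition degree_one_at :: "nat \<Rightarrow> (nat \<Rightarrow> complex) \<Rightarrow> bool" where
  "degree_one_at p f \<longleftrightarrow> multiplicative f \<and> degree_at p f 1"

definition conv_list :: "(nat \<Rightarrow> complex) list \<Rightarrow> nat \<Rightarrow> complex" where
  "conv_list fs = foldr (\<star>) fs conv_one"

definition degree_one_factorization_at ::
    "nat \<Rightarrow> nat \<Rightarrow> (nat \<Rightarrow> complex) \<Rightarrow> (nat \<Rightarrow> complex) list \<Rightarrow> bool" where
  "degree_one_factorization_at p m f fs \<longleftrightarrow>
     length fs = m \<and> (\<forall>g\<in>set fs. degree_one_at p g) \<and> agree_at p f (conv_list fs)"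

definition positive_at :: "nat \<Rightarrow> nat \<Rightarrow> (nat \<Rightarrow> complex) \<Rightarrow> bool" where
  "positive_at p m f \<longleftrightarrow>
     multiplicative f \<and> degree_at p f m \<and> (\<exists>fs. degree_one_factorization_at p m f fs)"

text \<open>
  A convolution product is represented by the list of its factors, so that a factor may
  be repeated. Two factors are mutually inverse if their product is trivial at \<open>p\<close>.
\<close>

definition normal_form_at :: "nat \<Rightarrow> (nat \<Rightarrow> complex) list \<Rightarrow> bool" where
  "normal_form_at p fs \<longleftrightarrow>
     (\<forall>f\<in>set fs. degree_one_at p f \<or> (\<exists>g. degree_one_at p g \<and> agree_at p f (conv_inverse g))) \<and>
     (\<forall>i<length fs. \<forall>j<length fs. i \<noteq> j \<longrightarrow> \<not> agree_at p (fs ! i \<star> fs ! j) conv_one)"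

end

theory Submission
  imports Defs "HOL-Computational_Algebra.Formal_Power_Series"
begin

text \<open>
  The generalized Fibonacci polynomials satisfy the linear recursion
  \<open>F\<^sub>n = t\<^sub>1 F\<^sub>n\<^sub>-\<^sub>1 + \<dots> + t\<^sub>n F\<^sub>0\<close>, by the Pascal rule for multinomial coefficients. With
  \<open>t\<^sub>0 = -1\<close> this says that \<open>-t\<close> is inverse to \<open>F(t)\<close> for the Cauchy product, which is what
  Dirichlet convolution becomes on powers of \<open>p\<close>. So the parameters of \<open>\<gamma>\<inverse>\<close> are the negated
  values of \<open>\<gamma>\<close>, and a function of degree 1 is geometric.
\<close>

section \<open>Exponent tuples of given weight\<close>

text \<open>
  The number of variables \<open>N\<close> is decoupled from the weight \<open>n\<close>, and tuples are extended by \<open>0\<close>: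
  lowering an exponent then stays in the same index space, which
  \<^const>\<open>weighted_exponents\<close> does not allow.
\<close>

definition expo :: "nat \<Rightarrow> nat \<Rightarrow> (nat \<Rightarrow> nat) set" where
  "expo N n = {a. (\<forall>j. j \<notin> {1..N} \<longrightarrow> a j = 0) \<and> (\<Sum>j=1..N. j * a j) = n}"

definition wterm :: "nat \<Rightarrow> (nat \<Rightarrow> complex) \<Rightarrow> (nat \<Rightarrow> nat) \<Rightarrow> complex" where
  "wterm N t a =
     fact (\<Sum>j=1..N. a j) / (\<Prod>j=1..N. fact (a j)) * (\<Prod>j=1..N. t j ^ a j)"

lemma expo_weight_le:
  assumes "a \<in> expo N n"
  shows "j * a j \<le> n"
proof (cases "j \<in> {1..N}")
  case True
  then have "j * a j \<le> (\<Sum>j=1..N. j * a j)"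
    by (intro member_le_sum[of j "{1..N}" "\<lambda>j. j * a j"]) auto
  then show ?thesis using assms by (simp add: expo_def)
qed (use assms in \<open>auto simp: expo_def\<close>)

lemma expo_eq_0:
  assumes "a \<in> expo N n" "n < j"
  shows "a j = 0"
proof (rule ccontr)
  assume "a j \<noteq> 0"
  then have "j \<le> j * a j" by simp
  then show False using expo_weight_le[OF assms(1), of j] assms(2) by linarith
qed

lemma expo_le:
  assumes "a \<in> expo N n"
  shows "a j \<le> n"
proof (cases "j = 0")
  case True
  then show ?thesis using assms by (simp add: expo_def)
next
  case False
  then have "a j \<le> j * a j" by simp
  then show ?thesis using expo_weight_le[OF assms, of j] by linarith
qed

text \<open>A positive exponent at an index above \<open>n\<close> would alone exceed the weight
  \<open>n\<close>, so the additional variables all have exponent 0.\<close>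

lemma expo_mono: "n \<le> N \<Longrightarrow> expo N n = expo n n"
proof (intro set_eqI iffI)
  fix a assume "n \<le> N" and a: "a \<in> expo N n"
  then have "(\<Sum>j=1..N. j * a j) = (\<Sum>j=1..n. j * a j)"
    by (intro sum.mono_neutral_right) (auto simp: expo_eq_0)
  then show "a \<in> expo n n"
    using a expo_eq_0[OF a] by (auto simp: expo_def)
next
  fix a assume "n \<le> N" and a: "a \<in> expo n n"
  then have "(\<Sum>j=1..N. j * a j) = (\<Sum>j=1..n. j * a j)"
    by (intro sum.mono_neutral_right) (auto simp: expo_eq_0)
  then show "a \<in> expo N n"
    using a \<open>n \<le> N\<close> by (auto simp: expo_def)
qed

lemma wterm_mono:
  assumes "n \<le> N" "a \<in> expo N n"
  shows "wterm N t a = wterm n t a"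
proof -
  have z: "a j = 0" if "j \<in> {1..N} - {1..n}" for j
    using that expo_eq_0[OF assms(2)] by auto
  have "(\<Sum>j=1..N. a j) = (\<Sum>j=1..n. a j)"
    "(\<Prod>j=1..N. fact (a j) :: complex) = (\<Prod>j=1..n. fact (a j))"
    "(\<Prod>j=1..N. t j ^ a j) = (\<Prod>j=1..n. t j ^ a j)"
    using assms(1) z
    by (auto intro!: sum.mono_neutral_right prod.mono_neutral_right)
  then show ?thesis by (simp add: wterm_def)
qed

lemma gen_fib_eq_sum_expo_self: "gen_fib n t = sum (wterm n t) (expo n n)"
  unfolding gen_fib_def
\<comment> \<open>The two index sets differ only in the default outside \<open>{1..n}\<close>:
  \<open>undefined\<close> for extensional functions, 0 for \<open>expo\<close>.\<close>
proof (rule sum.reindex_bij_witness[where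
      i = "\<lambda>a. restrict a {1..n}" and j = "\<lambda>a j. if j \<in> {1..n} then a j else 0"], goal_cases)
  case (1 a)
  then show ?case by (auto simp: weighted_exponents_def PiE_def extensional_def)
next
  case (2 a)
  then show ?case by (auto simp: weighted_exponents_def expo_def)
next
  case (3 a)
  then show ?case by (auto simp: expo_def restrict_def fun_eq_iff)
next
  case (4 a)
  then show ?case
    using expo_le[OF 4] by (auto simp: weighted_exponents_def expo_def)
next
  case (5 a)
  then show ?case by (simp add: wterm_def)
qed

lemma gen_fib_eq_sum_expo: "n \<le> N \<Longrightarrow> gen_fib n t = sum (wterm N t) (expo N n)"
  by (simp add: gen_fib_eq_sum_expo_self expo_mono[of n N] wterm_mono)

lemma finite_expo [simp]: "finite (expo N n)"
proof -
  have "expo N n \<subseteq> {a. \<forall>j. (j \<in> {1..N} \<longrightarrow> a j \<in> {..n}) \<and> (j \<notin> {1..N} \<longrightarrow> a j = 0)}"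
    using expo_le by (auto simp: expo_def)
  then show ?thesis
    by (rule finite_subset) (intro finite_set_of_finite_funs; simp)
qed

section \<open>Pascal rule and linear recursion\<close>

text \<open>Lowering one exponent divides the factorial on top by the total degree and the i-th one
  below by \<open>a i\<close>; the missing factor \<open>t i\<close> is restored on the
  left.\<close>

lemma wterm_fun_upd_pred:
  assumes "i \<in> {1..N}" "a i \<ge> 1"
  shows "t i * wterm N t (a(i := a i - 1)) =
    of_nat (a i) / of_nat (\<Sum>j=1..N. a j) * wterm N t a"
proof -
  let ?b = "a(i := a i - 1)" and ?A = "{1..N} - {i}"
  obtain m where m: "a i = Suc m" using assms(2) by (cases "a i") auto
  have eq: "(\<Sum>j\<in>?A. ?b j) = (\<Sum>j\<in>?A. a j)"
    "(\<Prod>j\<in>?A. fact (?b j) :: complex) = (\<Prod>j\<in>?A. fact (a j))"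
    "(\<Prod>j\<in>?A. t j ^ ?b j) = (\<Prod>j\<in>?A. t j ^ a j)"
    by (auto intro!: sum.cong prod.cong)
  define S where "S = (\<Sum>j\<in>?A. a j)"
  define P where "P = (\<Prod>j\<in>?A. fact (a j) :: complex)"
  define T where "T = (\<Prod>j\<in>?A. t j ^ a j)"
  have b: "wterm N t ?b = fact (m + S) / (fact m * P) * (t i ^ m * T)"
    unfolding wterm_def sum.remove[OF finite_atLeastAtMost assms(1)]
      prod.remove[OF finite_atLeastAtMost assms(1)] eq
    by (simp add: m S_def P_def T_def)
  have a: "wterm N t a = fact (Suc (m + S)) / (fact (Suc m) * P) * (t i ^ Suc m * T)"
    "(\<Sum>j=1..N. a j) = Suc (m + S)"
    unfolding wterm_def sum.remove[OF finite_atLeastAtMost assms(1)]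
      prod.remove[OF finite_atLeastAtMost assms(1)]
    by (simp_all add: m S_def P_def T_def)
  have "P \<noteq> 0" by (simp add: P_def)
  have "(of_nat (Suc m) :: complex) \<noteq> 0" "(of_nat (Suc (m + S)) :: complex) \<noteq> 0"
    by (simp_all only: of_nat_eq_0_iff)
  then show ?thesis
    unfolding b a unfolding m fact_Suc using \<open>P \<noteq> 0\<close> by (simp add: field_simps del: of_nat_Suc)
qed

text \<open>By \<open>wterm_fun_upd_pred\<close> the summands are the fractions of
  \<open>wterm N t a\<close> with weights \<open>a i\<close> over the total degree, and these
  weights add up to 1. The assumption on \<open>n\<close> keeps the total degree nonzero.\<close>

lemma wterm_pascal:
  assumes "a \<in> expo N n" "n \<ge> 1"
  shows "wterm N t a =
    (\<Sum>i=1..N. if a i \<ge> 1 then t i * wterm N t (a(i := a i - 1)) else 0)"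
proof -
  let ?S = "\<Sum>j=1..N. a j"
  have "?S \<noteq> 0"
  proof
    assume "?S = 0"
    then have "(\<Sum>j=1..N. j * a j) = 0" by simp
    then show False using assms by (simp add: expo_def)
  qed
  have "(\<Sum>i=1..N. if a i \<ge> 1 then t i * wterm N t (a(i := a i - 1)) else 0) =
      (\<Sum>i=1..N. of_nat (a i) / of_nat ?S * wterm N t a)"
    \<comment> \<open>Where \<open>a i = 0\<close>, both summands are 0.\<close>
    by (intro sum.cong refl) (auto simp only: wterm_fun_upd_pred split: if_splits, auto)
  also have "\<dots> = of_nat ?S / of_nat ?S * wterm N t a"
    by (simp only: sum_distrib_right[symmetric] sum_divide_distrib[symmetric] of_nat_sum)
  also have "\<dots> = wterm N t a"
    using \<open>?S \<noteq> 0\<close> by (simp only: divide_self of_nat_eq_0_iff not_False_eq_True mult_1)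
  finally show ?thesis by simp
qed

text \<open>The additive form avoids truncated subtraction and serves both for lowering and for
  raising an exponent.\<close>

lemma sum_fun_upd_weight:
  assumes "i \<in> {1..N}"
  shows "(\<Sum>j=1..N. j * (a(i := v)) j) + i * a i = (\<Sum>j=1..N. j * a j) + i * (v :: nat)"
proof -
  have "(\<Sum>j\<in>{1..N} - {i}. j * (a(i := v)) j) = (\<Sum>j\<in>{1..N} - {i}. j * a j)"
    by (intro sum.cong) auto
  then show ?thesis
    unfolding sum.remove[OF finite_atLeastAtMost assms] by simp
qed

text \<open>Apply the Pascal rule to each tuple and exchange the sums: for fixed \<open>i\<close>,
  lowering the i-th exponent is a bijection from the tuples with \<open>a i\<close> positive onto
  all tuples of weight \<open>n - i\<close>.\<close>

lemma gen_fib_rec: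
  assumes "n \<ge> 1"
  shows "gen_fib n t = (\<Sum>i=1..n. t i * gen_fib (n - i) t)"
proof -
  let ?w = "wterm n t"
  have *: "(\<Sum>a | a \<in> expo n n \<and> a i \<ge> 1. ?w (a(i := a i - 1))) = gen_fib (n - i) t"
    if i: "i \<in> {1..n}" for i
  proof -
    have "(\<Sum>a | a \<in> expo n n \<and> a i \<ge> 1. ?w (a(i := a i - 1))) = sum ?w (expo n (n - i))"
    proof (rule sum.reindex_bij_witness[where
          i = "\<lambda>b. b(i := Suc (b i))" and j = "\<lambda>a. a(i := a i - 1)"], goal_cases)
      case (2 a)
      then obtain m where "a i = Suc m" by (cases "a i") auto
      then show ?case
        using 2 i sum_fun_upd_weight[OF i, of a "a i - 1"] by (auto simp: expo_def)
    next
      case (4 b)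
      then show ?case
        using i sum_fun_upd_weight[OF i, of b "Suc (b i)"] by (auto simp: expo_def)
    qed auto
    \<comment> \<open>The lowered tuples still have \<open>n\<close> variables, although their
      weight is only \<open>n - i\<close>.\<close>
    then show ?thesis by (simp add: gen_fib_eq_sum_expo[of _ n])
  qed
  have "gen_fib n t = (\<Sum>a\<in>expo n n. \<Sum>i=1..n. if a i \<ge> 1 then t i * ?w (a(i := a i - 1)) else 0)"
    unfolding gen_fib_eq_sum_expo_self using assms by (intro sum.cong refl wterm_pascal)
  also have "\<dots> = (\<Sum>i=1..n. \<Sum>a\<in>expo n n. if a i \<ge> 1 then t i * ?w (a(i := a i - 1)) else 0)"
    by (rule sum.swap)
  also have "\<dots> = (\<Sum>i=1..n. t i * (\<Sum>a | a \<in> expo n n \<and> a i \<ge> 1. ?w (a(i := a i - 1))))"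
    by (auto simp: sum_distrib_left sum.inter_filter intro!: sum.cong)
  also have "\<dots> = (\<Sum>i=1..n. t i * gen_fib (n - i) t)"
    by (intro sum.cong refl) (simp only: *)
  finally show ?thesis .
qed

lemma gen_fib_geometric:
  assumes "\<forall>j>1. t j = 0"
  shows "gen_fib n t = t 1 ^ n"
proof (induction n)
  case (Suc n)
  have "gen_fib (Suc n) t = (\<Sum>i=1..Suc n. t i * gen_fib (Suc n - i) t)"
    by (intro gen_fib_rec) simp
  also have "\<dots> = (\<Sum>i\<in>{1}. t i * gen_fib (Suc n - i) t)"
    using assms by (intro sum.mono_neutral_right) auto
  finally show ?case using Suc by simp
qed (simp add: gen_fib_0)

section \<open>Arithmetic functions on powers of \<open>p\<close>\<close>

lemma degree_one_powers:
  assumes "degree_at p f 1"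
  shows "f (p ^ n) = f p ^ n"
proof -
  obtain t where t: "\<And>n. gen_fib n t = f (p ^ n)" "\<forall>j>1. t j = 0"
    using assms by (auto simp: degree_at_def parameters_at_def)
  \<comment> \<open>The instance at exponent 1 identifies \<open>t 1\<close> with
    \<open>f p\<close>.\<close>
  then show ?thesis
    using gen_fib_geometric[of t 1] gen_fib_geometric[of t n] by simp
qed

lemma dirichlet_conv_prime_power:
  assumes "prime p"
  shows "(f \<star> g) (p ^ n) = (\<Sum>j=0..n. f (p ^ j) * g (p ^ (n - j)))"
proof -
  have p: "p > 1" using assms by (rule prime_gt_1_nat)
  have "{d. d dvd p ^ n} = (^) p ` {0..n}"
    using assms by (auto simp: divides_primepow_nat)
  moreover have "inj_on ((^) p) {0..n}"
    using p by (intro inj_onI) (simp add: power_inject_exp)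
  ultimately show ?thesis
    using p by (simp add: dirichlet_conv_def sum.reindex power_diff)
qed

lemma multiplicative_1:
  assumes "multiplicative f"
  shows "f 1 = 1"
proof -
  obtain n where n: "n \<ge> 1" "f n \<noteq> 0" using assms by (auto simp: multiplicative_def)
  have "f (1 * n) = f 1 * f n" using assms n(1) unfolding multiplicative_def by auto
  then show ?thesis using n(2) by simp
qed

text \<open>Uniqueness of inverses among formal power series: on powers of \<open>p\<close>, both
  \<open>f\<close> and \<open>- s\<close> are inverse to the series of the
  \<open>gen_fib n s\<close>, the former by the definition of \<open>conv_inverse\<close>, the
  latter by \<open>gen_fib_rec\<close>.\<close>

lemma parameters_conv_inverse:
  assumes p: "prime p" and f: "multiplicative f"
    and s: "parameters_at p (conv_inverse f) s" "s 0 = -1"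
  shows "f (p ^ n) = - s n"
proof -
  have F: "conv_inverse f (p ^ n) = gen_fib n s" for n
    using s(1) by (simp add: parameters_at_def)
  let ?F = "Abs_fps (\<lambda>n. gen_fib n s)"
  let ?f = "Abs_fps (\<lambda>n. f (p ^ n))" and ?s = "Abs_fps (\<lambda>n. - s n)"
  have "?F * ?f = 1"
  proof (rule fps_ext)
    fix n
    have "fps_nth (?F * ?f) n = (conv_inverse f \<star> f) (p ^ n)"
      by (simp add: fps_mult_nth dirichlet_conv_prime_power[OF p] F)
    also have "\<dots> = conv_one (p ^ n)"
      using multiplicative_1[OF f] p by (intro dirichlet_conv_inverse) (simp_all add: Suc_le_eq prime_gt_0_nat)
    finally show "fps_nth (?F * ?f) n = fps_nth 1 n"
      using prime_gt_1_nat[OF p] by (auto simp: conv_one_def)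
  qed
  moreover have "?s * ?F = 1"
  proof (rule fps_ext)
    fix n
    show "fps_nth (?s * ?F) n = fps_nth 1 n"
    proof (cases "n = 0")
      case False
      \<comment> \<open>Since \<open>s 0 = -1\<close>, the term at \<open>i = 0\<close> is
        \<open>- gen_fib n s\<close>, which cancels the rest by the recursion.\<close>
      then have "(\<Sum>i=0..n. s i * gen_fib (n - i) s) = 0"
        using gen_fib_rec[of n s] s(2) by (simp add: sum.atLeast_Suc_atMost)
      then show ?thesis using False by (simp add: fps_mult_nth sum_negf)
    qed (simp add: s(2) gen_fib_0)
  qed
  ultimately have "?s = ?s * (?F * ?f)" "?s * ?F * ?f = ?f" by simp_all
  then have "fps_nth ?f n = fps_nth ?s n" by (simp only: mult.assoc)
  then show ?thesis by simp
qed

theorem theorem11: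
  fixes p k :: nat
    and \<alpha> \<beta> \<gamma> \<delta> :: "nat \<Rightarrow> complex"
    and \<delta>s :: "(nat \<Rightarrow> complex) list"
    and s'' :: "nat \<Rightarrow> complex"
  assumes "prime p" and "k \<ge> 2"
    and "multiplicative \<alpha>" and "multiplicative \<beta>" and "multiplicative \<gamma>"
    and "agree_at p \<alpha> (\<beta> \<star> \<gamma>)"
    and "positive_at p 1 \<beta>"
    and "positive_at p (k - 1) \<delta>" and "agree_at p \<gamma> (conv_inverse \<delta>)"
    and "\<not> agree_at p \<alpha> conv_one"
    and "degree_one_factorization_at p (k - 1) \<delta> \<delta>s"
    and "normal_form_at p (\<beta> # map conv_inverse \<delta>s)"
    and "parameters_at p (conv_inverse \<gamma>) s''" and "s'' 0 = -1"
  shows "\<forall>n. \<alpha> (p ^ n) = - (\<Sum>j=0..n. \<beta> p ^ (n - j) * s'' j) \<and>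
             - (\<Sum>j=0..n. \<beta> p ^ (n - j) * s'' j) = (\<Sum>j=0..n. \<beta> p ^ (n - j) * \<gamma> (p ^ j))"
proof
  fix n
  have \<beta>: "\<beta> (p ^ m) = \<beta> p ^ m" for m
    using \<open>positive_at p 1 \<beta>\<close> by (intro degree_one_powers) (simp add: positive_at_def)
  \<comment> \<open>This includes \<open>j = 0\<close>, where the convention
    \<open>s'' 0 = -1\<close> matches the value 1 of \<gamma> at 1; hence the two sums of the claim
    agree term by term.\<close>
  have \<gamma>: "\<gamma> (p ^ j) = - s'' j" for j
    using assms parameters_conv_inverse by blast
  have "\<alpha> (p ^ n) = (\<Sum>j=0..n. \<beta> p ^ j * \<gamma> (p ^ (n - j)))"
    using assms by (simp add: agree_at_def dirichlet_conv_prime_power \<beta>)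
  also have "\<dots> = (\<Sum>j=0..n. \<beta> p ^ (n - j) * \<gamma> (p ^ j))"
    by (subst sum.atLeastAtMost_rev) simp
  finally show "\<alpha> (p ^ n) = - (\<Sum>j=0..n. \<beta> p ^ (n - j) * s'' j) \<and>
             - (\<Sum>j=0..n. \<beta> p ^ (n - j) * s'' j) = (\<Sum>j=0..n. \<beta> p ^ (n - j) * \<gamma> (p ^ j))"
    by (simp add: \<gamma> sum_negf)
qed

end
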